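(* For every integer $k\geq 7$, there is no polynomial $f(q)$ such that $F_k(q)+f(q)$ is of Bloch--Pólya type.
   Context: A polynomial (or power series) in $q$ is said to be of Bloch--Pólya type if all of its coefficients belong to the set $\{-1,0,1\}$. For a non-negative integer $j$, $(q;q)_j=\prod_{i=1}^{j}(1-q^i)$, with $(q;q)_0=1$. For a positive integer $k$, $F_k(q)=\sum_{j\geq 0}q^{kj}(q;q)_j$, regarded as a power series in $q$ (it converges for $|q|<1$, and as a formal power series). *)

theory Defs
  imports "HOL-Analysis.Analysis" "HOL-Computational_Algebra.Computational_Algebra"
begin

definition qpoch :: "nat \<Rightarrow> 'a::comm_ring_1 fps" where
  "qpoch j = (\<Prod>i=1..j. 1 - fps_X ^ i)"

text \<open>The infinite sum is taken in the library's metric (i.e. the \<open>X\<close>-adic) topology on formal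
  power series. It is meant for positive \<open>k\<close>: convergence is shown in \<open>F_series_sums\<close> below,
  and for \<open>k = 0\<close> the sum is unspecified.\<close>

definition F_series :: "nat \<Rightarrow> 'a::comm_ring_1 fps" where
  "F_series k = (\<Sum>j. fps_X ^ (k * j) * qpoch j)"

text \<open>A polynomial \<open>p\<close> is of this type iff \<open>fps_of_poly p\<close> is.\<close>

definition bloch_polya :: "'a::comm_ring_1 fps \<Rightarrow> bool" where
  "bloch_polya A \<longleftrightarrow> (\<forall>n. fps_nth A n \<in> {-1, 0, 1})"

lemma F_series_sums:
  assumes "k \<ge> 1"
  shows "(\<lambda>j. fps_X ^ (k * j) * qpoch j) sums (F_series k :: 'a::comm_ring_1 fps)"
proof -
  let ?t = "\<lambda>j. fps_X ^ (k * j) * qpoch j :: 'a fps"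
  have vanish: "fps_nth (?t j) n = 0" if "n < j" for j n
  proof -
    have "j \<le> k * j" using assms by simp
    with that have "n < k * j" by linarith
    then show ?thesis by (simp add: fps_X_power_mult_nth)
  qed
  have "(\<lambda>m. \<Sum>j<m. ?t j) \<longlonglongrightarrow> Abs_fps (\<lambda>n. \<Sum>j\<le>n. fps_nth (?t j) n)"
  proof (rule tendsto_fpsI)
    fix n
    have "fps_nth (\<Sum>j<m. ?t j) n = (\<Sum>j\<le>n. fps_nth (?t j) n)" if "m > n" for m
      unfolding fps_sum_nth using that vanish
      by (intro sum.mono_neutral_right) auto
    then show "\<forall>\<^sub>F m in sequentially. fps_nth (\<Sum>j<m. ?t j) n =
        fps_nth (Abs_fps (\<lambda>n. \<Sum>j\<le>n. fps_nth (?t j) n)) n"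
      unfolding fps_nth_Abs_fps by (intro eventually_mono[OF eventually_gt_at_top[of n]])
  qed
  then have "summable ?t" unfolding summable_def sums_def by blast
  then show ?thesis unfolding F_series_def by (rule summable_sums)
qed

end

theory Submission
  imports Defs
begin

text \<open>
  Write \<open>(q)\<^sub>n\<close> for \<open>(q;q)\<^sub>n\<close> and \<open>E = (q;q)\<^sub>\<infinity>\<close>. Since \<open>(q)\<^bsub>j+1\<^esub> = (1 - q\<^bsup>j+1\<^esup>) (q)\<^sub>j\<close>, the
  series satisfy \<open>q\<^bsup>k+1\<^esup> F\<^bsub>k+1\<^esub> = 1 - (1 - q\<^bsup>k\<^esup>) F\<^sub>k\<close>, and \<open>q F\<^sub>1 = 1 - E\<close>, so up to a power of \<open>q\<close>, a
  sign and a polynomial, \<open>F\<^bsub>k+1\<^esub>\<close> is \<open>(q)\<^sub>k E\<close>. By the pentagonal number theorem \<open>E\<close> is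
  lacunary with coefficients \<open>\<plusminus>1\<close>, so every coefficient of \<open>(q)\<^sub>k\<close> recurs infinitely often, up to
  sign, in \<open>(q)\<^sub>k E\<close>. It remains to see that \<open>(q)\<^sub>n\<close> is not of Bloch--Polya type for \<open>n \<ge> 6\<close>.
  This follows from \<open>(q)\<^sub>n = \<Sum>\<^sub>j q\<^bsup>j(n+1)\<^esup> (q\<^bsup>j+1\<^esup>;q)\<^sub>\<infinity>\<close>: the coefficients of \<open>(q\<^sup>2;q)\<^sub>\<infinity>\<close> lie in
  \<open>{-1,0,1}\<close>, whereas \<open>(q\<^sup>3;q)\<^sub>\<infinity>\<close> has the coefficient \<open>4\<close> at \<open>q\<^bsup>69\<^esup>\<close>. That settles \<open>n \<ge> 69\<close>. For
  smaller \<open>n\<close> a coefficient \<open>\<plusminus>2\<close> is found by inspection, mostly at a pentagonal exponent, where the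
  contributions of \<open>E\<close> and of \<open>q\<^bsup>n+1\<^esup> (q\<^sup>2;q)\<^sub>\<infinity>\<close> reinforce each other.
\<close>

section \<open>The polynomials (q)_n: integer coefficients and degree\<close>

lemma qpoch_0 [simp]: "qpoch 0 = 1"
  by (simp add: qpoch_def)

lemma qpoch_Suc: "qpoch (Suc n) = qpoch n * (1 - fps_X ^ Suc n)"
  by (simp add: qpoch_def mult.commute)

text \<open>All coefficient computations are done over the integers; this carries them to the
  complex series of the theorem.\<close>

lemma fps_nth_qpoch_of_int:
  "fps_nth (qpoch n :: 'a::comm_ring_1 fps) i = of_int (fps_nth (qpoch n) i)"
proof (induction n arbitrary: i)
  case (Suc n)
  show ?case
    unfolding qpoch_Suc right_diff_distrib mult_1_right fps_sub_nth fps_X_power_mult_right_nth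
    by (simp add: Suc del: power_Suc)
qed simp

definition tri :: "nat \<Rightarrow> nat" where
  "tri s = s * (s + 1) div 2"

lemma tri_0 [simp]: "tri 0 = 0"
  by (simp add: tri_def)

lemma tri_Suc: "tri (Suc s) = tri s + Suc s"
  by (simp add: tri_def)

lemma fps_nth_qpoch_eq_0:
  assumes "i > tri n"
  shows "fps_nth (qpoch n) i = 0"
  using assms
proof (induction n arbitrary: i)
  case (Suc n)
  then have "tri n < i" "tri n < i - Suc n" "Suc n \<le> i"
    by (simp_all add: tri_Suc)
  then show ?case
    unfolding qpoch_Suc right_diff_distrib mult_1_right fps_sub_nth fps_X_power_mult_right_nth
    by (simp add: Suc.IH del: power_Suc)
qed simp

section \<open>Pentagonal numbers and the finite form of Euler's theorem\<close>

text \<open>The companion pentagonal number (m+1)(3(m+1)-1)/2 is written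
  \<open>pent m + 2 * m + 1\<close> throughout, which avoids subtraction on naturals.\<close>

definition pent :: "nat \<Rightarrow> nat" where
  "pent m = m * (3 * m + 1) div 2"

lemma pent_0 [simp]: "pent 0 = 0"
  by (simp add: pent_def)

lemma pent_Suc: "pent (Suc m) = pent m + 3 * m + 2"
proof -
  have "Suc m * (3 * Suc m + 1) = m * (3 * m + 1) + (3 * m + 2) * 2"
    by (simp add: algebra_simps)
  then show ?thesis
    unfolding pent_def by simp
qed

lemma pent_ge: "m \<le> pent m"
  by (induction m) (simp_all add: pent_Suc)

definition pent_sum :: "nat \<Rightarrow> 'a::comm_ring_1 fps" where
  "pent_sum n = 1 + (\<Sum>m<n. (-1) ^ Suc m * (fps_X ^ (pent m + 2 * m + 1) + fps_X ^ pent (Suc m)))"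

definition qprod :: "nat \<Rightarrow> nat \<Rightarrow> 'a::comm_ring_1 fps" where
  "qprod s n = (\<Prod>i=Suc s..n. 1 - fps_X ^ i)"

lemma qprod_0: "qprod 0 n = qpoch n"
  by (simp add: qprod_def qpoch_def)

lemma qprod_same [simp]: "qprod n n = 1"
  by (simp add: qprod_def)

lemma qprod_Suc_right: "s \<le> n \<Longrightarrow> qprod s (Suc n) = qprod s n * (1 - fps_X ^ Suc n)"
  by (simp add: qprod_def mult.commute)

lemma qprod_Suc_left: "s < n \<Longrightarrow> qprod s n = (1 - fps_X ^ Suc s) * qprod (Suc s) n"
  unfolding qprod_def by (rule prod.atLeast_Suc_atMost) simp

lemma pent_eq_tri: "pent m = m * m + tri m"
  by (induction m) (simp_all add: pent_Suc tri_Suc)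

text \<open>Shanks's finite form of the pentagonal number theorem: the sum over \<open>s \<le> n\<close> of these terms is
  a partial sum of Euler's series, while its \<open>s = 0\<close> term is \<open>qpoch n\<close> and all others vanish to order
  greater than \<open>n\<close>.\<close>

definition shanks_term :: "nat \<Rightarrow> nat \<Rightarrow> 'a::comm_ring_1 fps" where
  "shanks_term n s = (-1) ^ s * qprod s n * fps_X ^ (s * n + tri s)"

text \<open>Splitting the factors 1 - q^(n+1) and 1 - q^(t+1) off the two products makes all but one
  boundary monomial cancel between neighbouring values of s.\<close>

lemma shanks_telescope:
  assumes "t \<le> n"
  shows "(\<Sum>s\<le>t. shanks_term (Suc n) s - shanks_term n s) =
    (- ((-1) ^ t * qprod t n * fps_X ^ (Suc t * Suc n + tri t)) :: 'a::comm_ring_1 fps)"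
  using assms
proof (induction t)
  case 0
  then show ?case
    by (simp add: shanks_term_def qprod_Suc_right algebra_simps)
next
  case (Suc t)
  \<comment> \<open>Writing every monomial relative to \<open>?Y\<close> reduces the induction step
    to the ring identity \<open>alg\<close>.\<close>
  let ?Q = "qprod (Suc t) n :: 'a fps" and ?Y = "fps_X ^ (Suc t * n + tri (Suc t)) :: 'a fps"
  have e1: "fps_X ^ (Suc t * Suc n + tri t) = ?Y"
    by (rule arg_cong[where f="(^) fps_X"]) (simp add: tri_Suc)
  have e2: "fps_X ^ (Suc t * Suc n + tri (Suc t)) = ?Y * fps_X ^ Suc t"
    unfolding power_add[symmetric] by (rule arg_cong[where f="(^) fps_X"]) simp
  have e3: "fps_X ^ (Suc (Suc t) * Suc n + tri (Suc t)) = ?Y * fps_X ^ Suc t * fps_X ^ Suc n"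
    unfolding power_add[symmetric] by (rule arg_cong[where f="(^) fps_X"]) simp
  have q1: "qprod t n = (1 - fps_X ^ Suc t) * ?Q"
    using Suc.prems by (intro qprod_Suc_left) simp
  have q2: "qprod (Suc t) (Suc n) = ?Q * (1 - fps_X ^ Suc n)"
    using Suc.prems by (intro qprod_Suc_right) simp
  have sg: "(- 1) ^ Suc t = - ((- 1) ^ t :: 'a fps)"
    by simp
  have alg: "- (e * ((1 - x) * Q) * Y) + (- e * (Q * (1 - z)) * (Y * x) - - e * Q * Y)
      = - (- e * Q * (Y * x * z))" for e x z Q Y :: "'a fps"
    by (simp add: algebra_simps)
  show ?case
    unfolding sum.atMost_Suc Suc.IH[OF Suc_leD[OF Suc.prems]]
    unfolding shanks_term_def q2 e1 e2 e3 q1 sg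
    by (rule alg)
qed

text \<open>From n to n + 1, the boundary term of the telescope and the new term s = n + 1 are
  exactly the next pair of Euler's series.\<close>

lemma shanks: "(\<Sum>s\<le>n. shanks_term n s) = (pent_sum n :: 'a::comm_ring_1 fps)"
proof (induction n)
  case 0
  then show ?case
    by (simp add: shanks_term_def pent_sum_def)
next
  case (Suc n)
  have e1: "Suc n * Suc n + tri n = pent n + 2 * n + 1"
    by (simp add: pent_eq_tri)
  have e2: "Suc n * Suc n + tri (Suc n) = pent (Suc n)"
    by (simp only: pent_eq_tri)
  have "(\<Sum>s\<le>Suc n. shanks_term (Suc n) s) = (\<Sum>s\<le>n. shanks_term n s)
      + (\<Sum>s\<le>n. shanks_term (Suc n) s - shanks_term n s)
      + (shanks_term (Suc n) (Suc n) :: 'a fps)"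
    by (simp add: sum_subtractf)
  also have "\<dots> = pent_sum n + - ((-1) ^ n * fps_X ^ (pent n + 2 * n + 1))
      + (-1) ^ Suc n * fps_X ^ pent (Suc n)"
    unfolding Suc.IH shanks_telescope[OF le_refl] shanks_term_def[of "Suc n" "Suc n"] qprod_same
      e1 e2 by simp
  also have "\<dots> = pent_sum (Suc n)"
    by (simp add: pent_sum_def distrib_left del: power_Suc) simp
  finally show ?case .
qed

lemma qpoch_nth_eq_pent_sum:
  assumes "N \<le> n"
  shows "fps_nth (qpoch n :: 'a::comm_ring_1 fps) N = fps_nth (pent_sum n) N"
proof -
  have "fps_nth (shanks_term n s :: 'a fps) N = 0" if "s > 0" for s
  proof -
    obtain t where "s = Suc t" using \<open>s > 0\<close> by (auto simp: gr0_conv_Suc)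
    then have "N < s * n + tri s"
      using assms by (simp add: tri_Suc)
    then show ?thesis
      unfolding shanks_term_def fps_X_power_mult_right_nth by simp
  qed
  then have "(\<Sum>s\<le>n. fps_nth (shanks_term n s :: 'a fps) N)
      = (\<Sum>s\<in>{0}. fps_nth (shanks_term n s) N)"
    by (intro sum.mono_neutral_right) auto
  then show ?thesis
    unfolding shanks[symmetric] fps_sum_nth by (simp add: shanks_term_def[of _ 0] qprod_0)
qed

section \<open>Coefficients of the Euler product and their partial sums\<close>

definition euler :: "int fps" where
  "euler = Abs_fps (\<lambda>N. fps_nth (qpoch N) N)"

lemma qpoch_nth_stable:
  assumes "N \<le> n"
  shows "fps_nth (qpoch n) N = fps_nth euler N"
  using assms
proof (induction rule: dec_induct)
  case (step n)
  then show ?case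
    unfolding qpoch_Suc right_diff_distrib mult_1_right fps_sub_nth fps_X_power_mult_right_nth
    by (simp del: power_Suc)
qed (simp add: euler_def)

text \<open>Partial summation is division by 1 - q, so these are the coefficients of
  (q^2;q)_\<infinity>.\<close>

definition euler_sum :: "nat \<Rightarrow> int" where
  "euler_sum r = (\<Sum>i\<le>r. fps_nth euler i)"

definition pent_acc :: "nat \<Rightarrow> nat \<Rightarrow> int" where
  "pent_acc n r = (\<Sum>i\<le>r. fps_nth (pent_sum n) i)"

lemma euler_sum_eq_pent_acc: "r \<le> n \<Longrightarrow> euler_sum r = pent_acc n r"
  unfolding euler_sum_def pent_acc_def
  by (intro sum.cong refl) (simp add: qpoch_nth_stable[symmetric, of _ n] qpoch_nth_eq_pent_sum)

lemma sum_fps_X_power_nth: "(\<Sum>i\<le>r. fps_nth (fps_X ^ a) i) = (if a \<le> r then 1 else (0::int))"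
  by (simp add: fps_X_power_nth sum.delta' cong: if_cong)

lemma pent_acc_0: "pent_acc 0 r = 1"
  using sum_fps_X_power_nth[of 0 r] by (simp add: pent_acc_def pent_sum_def)

lemma pent_acc_Suc:
  "pent_acc (Suc n) r = pent_acc n r
    - (-1) ^ n * (of_bool (pent n + 2 * n + 1 \<le> r) + of_bool (pent n + 3 * n + 2 \<le> r))"
proof -
  have sg: "(-1) ^ k * f = fps_const ((-1) ^ k) * f" for k and f :: "int fps"
    by (simp flip: fps_const_power fps_const_neg)
  have "pent_acc (Suc n) r = pent_acc n r + (\<Sum>i\<le>r. fps_nth
     ((-1) ^ Suc n * (fps_X ^ (pent n + 2 * n + 1) + fps_X ^ pent (Suc n))) i)"
    by (simp add: pent_acc_def pent_sum_def sum.distrib sum_subtractf sum_negf del: power_Suc)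
  also have "\<dots> = pent_acc n r + (-1) ^ Suc n * ((\<Sum>i\<le>r. fps_nth (fps_X ^ (pent n + 2 * n + 1)) i)
     + (\<Sum>i\<le>r. fps_nth (fps_X ^ pent (Suc n)) i))"
    unfolding sg fps_mult_left_const_nth fps_add_nth by (simp only: sum.distrib sum_distrib_left distrib_left)
  also have "\<dots> = pent_acc n r
    - (-1) ^ n * (of_bool (pent n + 2 * n + 1 \<le> r) + of_bool (pent n + 3 * n + 2 \<le> r))"
    unfolding sum_fps_X_power_nth pent_Suc by simp
  finally show ?thesis .
qed

lemma pent_acc_ge: "pent n \<le> r \<Longrightarrow> pent_acc n r = (-1) ^ n"
  by (induction n) (simp_all add: pent_acc_0 pent_acc_Suc pent_Suc)

lemma pent_mono: "m \<le> n \<Longrightarrow> pent m \<le> pent n"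
  by (induction rule: dec_induct) (simp_all add: pent_Suc)

lemma pent_acc_stable:
  assumes "m \<le> n" "r < pent m + 2 * m + 1"
  shows "pent_acc n r = pent_acc m r"
  using assms(1)
proof (induction rule: dec_induct)
  case (step n)
  then show ?case
    using assms pent_mono[of m n] by (simp add: pent_acc_Suc)
qed simp

text \<open>The exponents \<open>pent l + 2 * l + 1\<close> and \<open>pent (Suc l)\<close> carry
  the same sign -(-1)^l, so the partial sums pass from (-1)^l through 0 to (-1)^(l+1).\<close>

lemma euler_sum_plateau:
  assumes "pent m \<le> r" "r \<le> pent m + 2 * m"
  shows "euler_sum r = (-1) ^ m"
proof -
  have "m \<le> r" using assms pent_ge[of m] by simp
  then show ?thesis
    using assms euler_sum_eq_pent_acc[of r r] pent_acc_stable[of m r r] pent_acc_ge[of m r] by simp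
qed

lemma euler_sum_gap:
  assumes "pent m + 2 * m < r" "r < pent (Suc m)"
  shows "euler_sum r = 0"
proof -
  have "Suc m \<le> r" using assms pent_ge[of m] by simp
  then show ?thesis
    using assms euler_sum_eq_pent_acc[of r r] pent_acc_stable[of "Suc m" r r] pent_acc_ge[of m r]
      pent_acc_Suc[of m r] pent_Suc[of m] by simp
qed

lemma pent_cases:
  obtains m where "pent m \<le> r" "r < pent (Suc m)"
proof -
  define m where "m = (LEAST m. r < pent (Suc m))"
  have "r < pent (Suc r)" using pent_ge[of "Suc r"] by simp
  then have 1: "r < pent (Suc m)" unfolding m_def by (rule LeastI)
  have "pent m \<le> r"
  proof (cases m)
    case (Suc l)
    then have "\<not> r < pent (Suc l)"
      using not_less_Least[of l "\<lambda>m. r < pent (Suc m)"] m_def by simp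
    then show ?thesis using Suc by simp
  qed simp
  with 1 show ?thesis using that by blast
qed

lemma abs_euler_sum_le: "\<bar>euler_sum r\<bar> \<le> 1"
proof -
  obtain m where "pent m \<le> r" "r < pent (Suc m)" by (rule pent_cases)
  then show ?thesis
    using euler_sum_plateau[of m r] euler_sum_gap[of m r] by (cases "r \<le> pent m + 2 * m") simp_all
qed

lemma euler_nth_Suc: "fps_nth euler (Suc r) = euler_sum (Suc r) - euler_sum r"
  by (simp add: euler_sum_def)

lemma euler_nth_pent:
  assumes "m > 0"
  shows "fps_nth euler (pent m) = (-1) ^ m"
proof -
  obtain l where l: "m = Suc l" using assms by (cases m) auto
  define r where "r = pent l + 3 * l + 1"
  have r: "pent m = Suc r" by (simp add: l r_def pent_Suc)
  have "euler_sum (Suc r) = (-1) ^ m"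
    using euler_sum_plateau[of m "Suc r"] r by simp
  moreover have "euler_sum r = 0"
    using r l by (intro euler_sum_gap[of l r]) (auto simp: r_def)
  ultimately show ?thesis unfolding r euler_nth_Suc by simp
qed

text \<open>The bounds are the two neighbouring pentagonal numbers, \<open>pent m - m\<close> and
  \<open>pent m + 2 * m + 1\<close>, so around \<open>pent m\<close> there are gaps growing with
  m.\<close>

lemma euler_nth_near_pent:
  assumes "pent m < i + m" "i \<le> pent m + 2 * m" "i \<noteq> pent m"
  shows "fps_nth euler i = 0"
proof -
  have "m > 0" using assms by (cases m) auto
  then obtain l where l: "m = Suc l" by (cases m) auto
  obtain j where j: "i = Suc j" using assms l pent_Suc[of l] by (cases i) auto
  show ?thesis
  proof (cases "i < pent m")
    case True
    then have "euler_sum i = 0" "euler_sum j = 0"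
      using euler_sum_gap[of l i] euler_sum_gap[of l j] assms l j pent_Suc[of l] by auto
    then show ?thesis unfolding j euler_nth_Suc by simp
  next
    case False
    then have "euler_sum i = (-1) ^ m" "euler_sum j = (-1) ^ m"
      using euler_sum_plateau[of m i] euler_sum_plateau[of m j] assms j by auto
    then show ?thesis unfolding j euler_nth_Suc by simp
  qed
qed

lemma euler_nth_after_plateau: "fps_nth euler (pent m + 2 * m + 1) = - ((-1) ^ m)"
  using euler_sum_plateau[of m "pent m + 2 * m"] euler_sum_gap[of m "pent m + 2 * m + 1"]
    euler_nth_Suc[of "pent m + 2 * m"] by (simp add: pent_Suc)

lemma abs_euler_nth_le: "\<bar>fps_nth euler i\<bar> \<le> 1"
proof -
  obtain m where m: "pent m \<le> i" "i < pent (Suc m)" by (rule pent_cases)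
  consider "m = 0" "i = pent m" | "m > 0" "i = pent m" | "i \<noteq> pent m" "i \<le> pent m + 2 * m"
    | "i = pent m + 2 * m + 1" | "pent m + 2 * m < i - 1"
    by linarith
  then show ?thesis
  proof cases
    case 1
    then show ?thesis by (simp add: euler_def)
  next
    case 2
    then show ?thesis by (simp add: euler_nth_pent)
  next
    case 3
    then have "m > 0" using m by (cases m) auto
    then show ?thesis using 3 m euler_nth_near_pent[of m i] by simp
  next
    case 4
    then show ?thesis by (simp only: euler_nth_after_plateau) simp
  next
    case 5
    then show ?thesis
      using m euler_sum_gap[of m i] euler_sum_gap[of m "i - 1"] euler_nth_Suc[of "i - 1"] by simp
  qed
qed

section \<open>Expansion of (q)_n up to order 3n+3\<close>

text \<open>Summing every second value of \<open>euler_sum\<close> divides by 1 - q^2, which gives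
  the coefficients of (q^3;q)_\<infinity>.\<close>

definition euler_dbl :: "nat \<Rightarrow> int" where
  "euler_dbl r = (\<Sum>i\<le>r div 2. euler_sum (r - 2 * i))"

lemma euler_dbl_Suc_Suc: "euler_dbl (Suc (Suc r)) = euler_sum (Suc (Suc r)) + euler_dbl r"
proof -
  have "Suc (Suc r) div 2 = Suc (r div 2)" by simp
  then show ?thesis
    unfolding euler_dbl_def by (simp only: sum.atMost_Suc_shift) simp
qed

lemma euler_dbl_rec:
  assumes "r \<ge> 2"
  shows "euler_dbl r = euler_sum r + euler_dbl (r - 2)"
proof -
  have "Suc (Suc (r - 2)) = r" using assms by simp
  then show ?thesis using euler_dbl_Suc_Suc[of "r - 2"] by (simp only:)
qed

lemma euler_dbl_less_2: "r < 2 \<Longrightarrow> euler_dbl r = euler_sum r"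
  by (simp add: euler_dbl_def)

lemma one_minus_X_euler_sum: "(1 - fps_X) * Abs_fps euler_sum = euler"
proof (rule fps_ext)
  fix n show "fps_nth ((1 - fps_X) * Abs_fps euler_sum) n = fps_nth euler n"
    by (cases n) (simp_all add: left_diff_distrib euler_nth_Suc, simp add: euler_sum_def)
qed

lemma one_minus_X2_euler_dbl: "(1 - fps_X ^ 2) * Abs_fps euler_dbl = Abs_fps euler_sum"
proof (rule fps_ext)
  fix n show "fps_nth ((1 - fps_X ^ 2) * Abs_fps euler_dbl) n = fps_nth (Abs_fps euler_sum) n"
    unfolding left_diff_distrib fps_sub_nth fps_X_power_mult_nth
    by (simp add: euler_dbl_less_2 euler_dbl_rec)
qed

text \<open>With \<open>(q;q)\<^sub>\<infinity>\<close>, \<open>(q\<^sup>2;q)\<^sub>\<infinity>\<close> and \<open>(q\<^sup>3;q)\<^sub>\<infinity>\<close> rendered as \<open>euler\<close>, \<open>Abs_fps euler_sum\<close> and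
  \<open>Abs_fps euler_dbl\<close>.\<close>

definition qpoch_err :: "nat \<Rightarrow> int fps" where
  "qpoch_err n = qpoch n - (euler + fps_X ^ (n + 1) * Abs_fps euler_sum
     + fps_X ^ (2 * n + 2) * Abs_fps euler_dbl)"

text \<open>Multiplying the three-term approximation by 1 - q^(n+1) yields the one for n + 1, by the
  relations between the three products, except for a single term of order 3n+3.\<close>

lemma qpoch_err_Suc:
  "qpoch_err (Suc n) = (1 - fps_X ^ (n + 1)) * qpoch_err n - fps_X ^ (3 * n + 3) * Abs_fps euler_dbl"
proof -
  define x y A B :: "int fps" where "x = fps_X" and "y = fps_X ^ (n + 1)"
    and "A = Abs_fps euler_sum" and "B = Abs_fps euler_dbl"
  have A: "euler = (1 - x) * A" using one_minus_X_euler_sum by (simp add: x_def A_def)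
  have B: "A = (1 - x ^ 2) * B" using one_minus_X2_euler_dbl by (simp add: x_def A_def B_def)
  have y: "fps_X ^ Suc n = y" "fps_X ^ (Suc n + 1) = x * y" "fps_X ^ (2 * n + 2) = y ^ 2"
      "fps_X ^ (2 * Suc n + 2) = x ^ 2 * y ^ 2" "fps_X ^ (3 * n + 3) = y ^ 3"
    unfolding x_def y_def power_mult[symmetric] power_add[symmetric] power_Suc[symmetric]
    by (rule arg_cong[where f="(^) fps_X"]; simp)+
  show ?thesis
    unfolding qpoch_err_def qpoch_Suc y A_def[symmetric] B_def[symmetric] y_def[symmetric] A
    unfolding B by (simp add: algebra_simps power2_eq_square power3_eq_cube)
qed

lemma qpoch_err_nth_eq_0:
  assumes "N < 3 * n + 3"
  shows "fps_nth (qpoch_err n) N = 0"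
  using assms
proof (induction N arbitrary: n rule: less_induct)
  case (less N)
  \<comment> \<open>Descending induction on n, starting at some M \<ge> N where (q)_M already agrees
    with \<open>euler\<close> at N; the shifted coefficient in the recurrence falls to the outer
    induction on N.\<close>
  have "fps_nth (qpoch_err n) N = 0" if "n \<le> M" "N < 3 * n + 3" "N \<le> M" for n M
    using that
  proof (induction rule: inc_induct)
    case base
    then show ?case
      unfolding qpoch_err_def fps_sub_nth fps_add_nth fps_X_power_mult_nth
      by (simp add: qpoch_nth_stable)
  next
    case (step m)
    have "fps_nth (qpoch_err m) (N - (m + 1)) = 0" if "m + 1 \<le> N"
      using that step.prems by (intro less.IH) auto
    moreover have "fps_nth (qpoch_err (Suc m)) N = 0"
      using step by simp
    ultimately show ?case
      using step.prems
      unfolding qpoch_err_Suc left_diff_distrib mult_1_left fps_sub_nth fps_X_power_mult_nth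
      by (simp split: if_splits)
  qed
  from this[of n "max n N"] less.prems show ?case by simp
qed

lemma qpoch_nth_near_1:
  assumes "r \<le> n"
  shows "fps_nth (qpoch n) (n + 1 + r) = fps_nth euler (n + 1 + r) + euler_sum r"
  using qpoch_err_nth_eq_0[of "n + 1 + r" n] assms
  unfolding qpoch_err_def fps_sub_nth fps_add_nth fps_X_power_mult_nth by simp

lemma qpoch_nth_near_2:
  assumes "r \<le> n"
  shows "fps_nth (qpoch n) (2 * n + 2 + r) =
    fps_nth euler (2 * n + 2 + r) + euler_sum (n + 1 + r) + euler_dbl r"
  using qpoch_err_nth_eq_0[of "2 * n + 2 + r" n] assms
  unfolding qpoch_err_def fps_sub_nth fps_add_nth fps_X_power_mult_nth by simp

section \<open>Recurrence for F_k and its reduction to (q)_k times the Euler product\<close>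

lemma F_series_nth:
  assumes "k \<ge> 1" "N \<le> M"
  shows "fps_nth (F_series k :: 'a::comm_ring_1 fps) N =
    (\<Sum>j\<le>M. fps_nth (fps_X ^ (k * j) * qpoch j) N)"
proof -
  let ?t = "\<lambda>j. fps_X ^ (k * j) * qpoch j :: 'a fps"
  have vanish: "fps_nth (?t j) N = 0" if "N < j" for j
  proof -
    have "j \<le> k * j" using assms by simp
    with that have "N < k * j" by linarith
    then show ?thesis by (simp add: fps_X_power_mult_nth)
  qed
  have "(\<lambda>m. \<Sum>j<m. ?t j) \<longlonglongrightarrow> F_series k"
    using F_series_sums[OF assms(1)] by (simp add: sums_def)
  then have "\<forall>\<^sub>F m in sequentially. fps_nth (\<Sum>j<m. ?t j) N = fps_nth (F_series k) N"
    by (simp add: tendsto_fps_iff)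
  then obtain m0 where "\<And>m. m \<ge> m0 \<Longrightarrow> fps_nth (\<Sum>j<m. ?t j) N = fps_nth (F_series k) N"
    by (auto simp: eventually_sequentially)
  from this[of "max m0 (Suc M)"]
  have "fps_nth (F_series k) N = (\<Sum>j<max m0 (Suc M). fps_nth (?t j) N)"
    by (simp add: fps_sum_nth)
  also have "\<dots> = (\<Sum>j\<le>M. fps_nth (?t j) N)"
    using assms(2) by (intro sum.mono_neutral_right) (auto intro!: vanish)
  finally show ?thesis .
qed

lemma F_series_nth_of_int:
  assumes "k \<ge> 1"
  shows "fps_nth (F_series k :: 'a::comm_ring_1 fps) N = of_int (fps_nth (F_series k) N)"
  unfolding F_series_nth[OF assms le_refl] fps_X_power_mult_nth
  by (simp add: fps_nth_qpoch_of_int[where 'a='a] if_distrib cong: if_cong)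

definition F_part :: "nat \<Rightarrow> nat \<Rightarrow> 'a::comm_ring_1 fps" where
  "F_part k M = (\<Sum>j\<le>M. fps_X ^ (k * j) * qpoch j)"

text \<open>Lets identities between the series be proved as exact polynomial identities between
  partial sums.\<close>

lemma mult_F_series_nth:
  assumes "k \<ge> 1" "N \<le> M"
  shows "fps_nth (A * F_series k :: 'a::comm_ring_1 fps) N = fps_nth (A * F_part k M) N"
proof -
  have "fps_nth (F_series k :: 'a fps) i = fps_nth (F_part k M) i" if "i \<le> N" for i
    using that assms by (simp only: F_series_nth[of k i M] F_part_def fps_sum_nth)
  then show ?thesis
    unfolding fps_mult_nth by (intro sum.cong refl) simp
qed

lemma F_series_1: "fps_X * F_series 1 = 1 - euler"
proof (rule fps_ext)
  fix N
  have "fps_X * F_part 1 M = (1 - qpoch (Suc M) :: int fps)" for M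
  proof (induction M)
    case (Suc M)
    have "fps_X * F_part 1 (Suc M)
      = (fps_X * F_part 1 M + fps_X ^ Suc (Suc M) * qpoch (Suc M) :: int fps)"
      by (simp add: F_part_def algebra_simps)
    then show ?case
      unfolding Suc.IH qpoch_Suc[of "Suc M"] by (simp add: algebra_simps del: power_Suc)
  qed (simp add: F_part_def qpoch_Suc)
  then show "fps_nth (fps_X * F_series 1) N = fps_nth (1 - euler) N"
    using mult_F_series_nth[of 1 N N "fps_X :: int fps"] by (simp add: qpoch_nth_stable)
qed

lemma F_series_Suc:
  assumes "k \<ge> 1"
  shows "fps_X ^ Suc k * F_series (Suc k) = (1 - (1 - fps_X ^ k) * F_series k :: 'a::comm_ring_1 fps)"
proof (rule fps_ext)
  fix N
  \<comment> \<open>The last sum runs one index further because q^(j+1) (q)_j = (q)_j - (q)_(j+1)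
    involves the next term.\<close>
  have part: "fps_X ^ Suc k * F_part (Suc k) M
      = (1 + fps_X ^ k * F_part k M - F_part k (Suc M) :: 'a fps)" for M
  proof (induction M)
    case 0
    then show ?case
      by (simp add: F_part_def qpoch_Suc algebra_simps)
  next
    case (Suc M)
    have e: "fps_X ^ (Suc k * Suc M) * fps_X ^ Suc k
        = (fps_X ^ (k * Suc (Suc M)) * fps_X ^ Suc (Suc M) :: 'a fps)"
      "fps_X ^ k * fps_X ^ (k * Suc M) = (fps_X ^ (k * Suc (Suc M)) :: 'a fps)"
      unfolding power_add[symmetric] by (rule arg_cong[where f="(^) fps_X"]; simp)+
    have "fps_X ^ Suc k * F_part (Suc k) (Suc M)
      = (fps_X ^ Suc k * F_part (Suc k) M
        + fps_X ^ (Suc k * Suc M) * fps_X ^ Suc k * qpoch (Suc M) :: 'a fps)"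
      unfolding F_part_def sum.atMost_Suc by (simp only: algebra_simps)
    also have "\<dots> = 1 + fps_X ^ k * F_part k M - F_part k (Suc M)
      + (fps_X ^ k * fps_X ^ (k * Suc M) * qpoch (Suc M)
         - fps_X ^ (k * Suc (Suc M)) * qpoch (Suc (Suc M)))"
      unfolding Suc.IH e qpoch_Suc[of "Suc M"] by (simp only: algebra_simps mult_1 mult_1_right)
    also have "\<dots> = 1 + fps_X ^ k * F_part k (Suc M) - F_part k (Suc (Suc M))"
      unfolding F_part_def sum.atMost_Suc by (simp only: algebra_simps)
    finally show ?case .
  qed
  have "fps_nth (fps_X ^ Suc k * F_series (Suc k) :: 'a fps) N
      = fps_nth (fps_X ^ Suc k * F_part (Suc k) N) N"
    by (intro mult_F_series_nth) auto
  also have "\<dots> = fps_nth 1 N + fps_nth (fps_X ^ k * F_series k) N - fps_nth (1 * F_series k) N"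
    unfolding part fps_sub_nth fps_add_nth
    using assms mult_F_series_nth[of k N N "fps_X ^ k :: 'a fps"]
      mult_F_series_nth[of k N "Suc N" "1 :: 'a fps"] by simp
  also have "\<dots> = fps_nth (1 - (1 - fps_X ^ k) * F_series k) N"
    by (simp add: left_diff_distrib)
  finally show "fps_nth (fps_X ^ Suc k * F_series (Suc k) :: 'a fps) N =
    fps_nth (1 - (1 - fps_X ^ k) * F_series k) N" .
qed

text \<open>The factors q^(j+1) of the successive recurrences accumulate to the power
  \<open>tri (Suc k)\<close>, kept on the left to avoid division.\<close>

lemma F_series_euler:
  "\<exists>p. fps_X ^ tri (Suc k) * F_series (Suc k) = fps_of_poly p - (-1) ^ k * qpoch k * euler"
proof (induction k)
  case 0
  have "fps_X ^ tri (Suc 0) * F_series (Suc 0) = fps_of_poly 1 - (-1) ^ 0 * qpoch 0 * euler"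
    using F_series_1 by (simp add: tri_Suc)
  then show ?case by blast
next
  case (Suc k)
  then obtain p where p: "fps_X ^ tri (Suc k) * F_series (Suc k)
      = fps_of_poly p - (-1) ^ k * qpoch k * euler" by blast
  have F: "fps_X ^ Suc (Suc k) * F_series (Suc (Suc k))
      = (1 - (1 - fps_X ^ Suc k) * F_series (Suc k) :: int fps)"
    by (rule F_series_Suc) simp
  have "fps_X ^ tri (Suc (Suc k)) * F_series (Suc (Suc k))
      = (fps_X ^ tri (Suc k) * (fps_X ^ Suc (Suc k) * F_series (Suc (Suc k))) :: int fps)"
    by (simp only: tri_Suc[of "Suc k"] power_add mult.assoc)
  also have "\<dots> = fps_X ^ tri (Suc k) - (1 - fps_X ^ Suc k) * (fps_X ^ tri (Suc k) * F_series (Suc k))"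
    unfolding F by (simp only: algebra_simps mult_1 mult_1_right)
  also have "\<dots> = fps_of_poly (monom 1 (tri (Suc k)) - (1 - monom 1 (Suc k)) * p)
      - (-1) ^ Suc k * qpoch (Suc k) * euler"
    unfolding p qpoch_Suc[of k]
    by (simp add: fps_of_poly_diff fps_of_poly_mult fps_of_poly_monom' algebra_simps del: power_Suc)
      (simp add: monom_Suc)
  finally show ?case by blast
qed

section \<open>A coefficient of (q)_n outside {-1,0,1} for n \<ge> 6\<close>

lemma euler_sum_values:
  "euler_sum 0 = 1" "euler_sum (Suc 0) = 0"
  "\<lbrakk>2 \<le> r; r \<le> 4\<rbrakk> \<Longrightarrow> euler_sum r = -1"
  "\<lbrakk>5 \<le> r; r \<le> 6\<rbrakk> \<Longrightarrow> euler_sum r = 0"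
  "\<lbrakk>7 \<le> r; r \<le> 11\<rbrakk> \<Longrightarrow> euler_sum r = 1"
  "\<lbrakk>12 \<le> r; r \<le> 14\<rbrakk> \<Longrightarrow> euler_sum r = 0"
  "\<lbrakk>15 \<le> r; r \<le> 21\<rbrakk> \<Longrightarrow> euler_sum r = -1"
  "\<lbrakk>22 \<le> r; r \<le> 25\<rbrakk> \<Longrightarrow> euler_sum r = 0"
  "\<lbrakk>26 \<le> r; r \<le> 34\<rbrakk> \<Longrightarrow> euler_sum r = 1"
  "\<lbrakk>35 \<le> r; r \<le> 39\<rbrakk> \<Longrightarrow> euler_sum r = 0"
  "\<lbrakk>40 \<le> r; r \<le> 50\<rbrakk> \<Longrightarrow> euler_sum r = -1"
  "\<lbrakk>51 \<le> r; r \<le> 56\<rbrakk> \<Longrightarrow> euler_sum r = 0"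
  "\<lbrakk>57 \<le> r; r \<le> 69\<rbrakk> \<Longrightarrow> euler_sum r = 1"
  subgoal using euler_sum_plateau[of 0 0] by simp
  subgoal using euler_sum_gap[of 0 1] by (simp add: pent_def)
  subgoal using euler_sum_plateau[of 1 r] by (simp add: pent_def)
  subgoal using euler_sum_gap[of 1 r] by (simp add: pent_def)
  subgoal using euler_sum_plateau[of 2 r] by (simp add: pent_def)
  subgoal using euler_sum_gap[of 2 r] by (simp add: pent_def)
  subgoal using euler_sum_plateau[of 3 r] by (simp add: pent_def)
  subgoal using euler_sum_gap[of 3 r] by (simp add: pent_def)
  subgoal using euler_sum_plateau[of 4 r] by (simp add: pent_def)
  subgoal using euler_sum_gap[of 4 r] by (simp add: pent_def)
  subgoal using euler_sum_plateau[of 5 r] by (simp add: pent_def)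
  subgoal using euler_sum_gap[of 5 r] by (simp add: pent_def)
  subgoal using euler_sum_plateau[of 6 r] by (simp add: pent_def)
  done

lemma euler_dbl_values: "euler_dbl 0 = 1" "euler_dbl 3 = -1" "euler_dbl 5 = -1" "euler_dbl 69 = 4"
  by (simp_all add: euler_dbl_less_2 euler_dbl_rec euler_sum_values)

lemma qpoch_coeff_large:
  assumes "n \<ge> 6"
  shows "\<exists>i. \<bar>fps_nth (qpoch n) i\<bar> > (1 :: int)"
proof (rule ccontr)
  assume "\<not> ?thesis"
  then have bound: "\<bar>fps_nth (qpoch n) i\<bar> \<le> (1 :: int)" for i
    by (simp add: not_less)
  \<comment> \<open>The exponent \<open>pent a\<close> meets plateau m of the copy of
    \<open>euler_sum\<close> shifted by n + 1; equal parity means equal signs, hence a coefficient 2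
    or -2.\<close>
  have hi: False if "pent m + n < pent a" "pent a \<le> pent m + 2 * m + n + 1" "pent a \<le> 2 * n + 1"
    "even a = even m" for a m
  proof -
    define r where "r = pent a - (n + 1)"
    have r: "pent a = n + 1 + r" "pent m \<le> r" "r \<le> pent m + 2 * m" "r \<le> n"
      using that by (simp_all add: r_def)
    have "a > 0" using r(1) by (cases a) auto
    then have "fps_nth euler (n + 1 + r) = (-1) ^ m"
      using that r euler_nth_pent[of a] by (simp add: minus_one_power_iff)
    then show False
      using bound[of "n + 1 + r"] qpoch_nth_near_1[of r n] euler_sum_plateau[of m r] r
      by (simp add: minus_one_power_iff split: if_splits)
  qed
  \<comment> \<open>The same at the companion exponent, whose sign is -(-1)^a; hence the opposite
    parity condition.\<close>
  have lo: False if "pent m + n < pent a + 2 * a + 1" "pent a + 2 * a \<le> pent m + 2 * m + n"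
    "pent a + 2 * a \<le> 2 * n" "even a \<noteq> even m" for a m
  proof -
    define r where "r = pent a + 2 * a - n"
    have r: "pent a + 2 * a + 1 = n + 1 + r" "pent m \<le> r" "r \<le> pent m + 2 * m" "r \<le> n"
      using that by (simp_all add: r_def)
    have "fps_nth euler (n + 1 + r) = (-1) ^ m"
      using that r euler_nth_after_plateau[of a] by (auto simp: minus_one_power_iff)
    then show False
      using bound[of "n + 1 + r"] qpoch_nth_near_1[of r n] euler_sum_plateau[of m r] r
      by (simp add: minus_one_power_iff split: if_splits)
  qed
  \<comment> \<open>Here the exponent lies in a gap of \<open>euler\<close> around
    \<open>pent m\<close>, so only the other two contributions remain.\<close>
  have second: False if "\<bar>euler_sum (n + 1 + r) + euler_dbl r\<bar> > 1" "r \<le> n"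
    "pent m < 2 * n + 2 + r + m" "2 * n + 2 + r \<le> pent m + 2 * m" "2 * n + 2 + r \<noteq> pent m" for m r
    using that bound[of "2 * n + 2 + r"] qpoch_nth_near_2[of r n]
      euler_nth_near_pent[of m "2 * n + 2 + r"] by simp
  \<comment> \<open>The value \<open>euler_dbl 69 = 4\<close> cannot be brought below 2 by two terms
    of absolute value at most 1.\<close>
  have "n < 69"
  proof (rule ccontr)
    assume "\<not> n < 69"
    then have "\<bar>fps_nth euler (2 * n + 2 + 69) + euler_sum (n + 1 + 69) + 4\<bar> \<le> 1"
      using bound[of "2 * n + 2 + 69"] qpoch_nth_near_2[of 69 n] euler_dbl_values by simp
    then show False
      using abs_euler_nth_le[of "2 * n + 2 + 69"] abs_euler_sum_le[of "n + 1 + 69"] by linarith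
  qed
  \<comment> \<open>Each instance excludes a short range of n, raising the lower bound. The
    arguments are m, a for \<open>hi\<close> and \<open>lo\<close>, and r, m for
    \<open>second\<close>.\<close>
  have "n \<ge> 7"
    using assms hi[of 0 2] by (cases "n \<le> 6") (simp_all add: pent_def)
  then have "n \<ge> 10"
    using lo[of 1 2] by (cases "n \<le> 9") (simp_all add: pent_def)
  then have "n \<ge> 13"
    using hi[of 1 3] by (cases "n \<le> 12") (simp_all add: pent_def)
  then have "n \<ge> 15"
    using lo[of 2 3] by (cases "n \<le> 14") (simp_all add: pent_def)
  then have "n \<ge> 19"
    using hi[of 2 4] by (cases "n \<le> 18") (simp_all add: pent_def)
  then have "n \<ge> 20"
    using lo[of 3 4] by (cases "n \<le> 19") (simp_all add: pent_def)
  then have "n \<ge> 25"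
    using hi[of 3 5] by (cases "n \<le> 24") (simp_all add: pent_def)
  then have "n \<ge> 26"
    using hi[of 0 4] by (cases "n \<le> 25") (simp_all add: pent_def)
  then have "n \<ge> 27"
    using second[of 0 6] by (cases "n \<le> 26") (simp_all add: pent_def euler_dbl_values euler_sum_values)
  then have "n \<ge> 28"
    using second[of 0 6] by (cases "n \<le> 27") (simp_all add: pent_def euler_dbl_values euler_sum_values)
  then have "n \<ge> 31"
    using hi[of 4 6] by (cases "n \<le> 30") (simp_all add: pent_def)
  then have "n \<ge> 33"
    using lo[of 1 4] by (cases "n \<le> 32") (simp_all add: pent_def)
  then have "n \<ge> 34"
    using second[of 0 6] by (cases "n \<le> 33") (simp_all add: pent_def euler_dbl_values euler_sum_values)
  then have "n \<ge> 35"
    using second[of 5 7] by (cases "n \<le> 34") (simp_all add: pent_def euler_dbl_values euler_sum_values)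
  then have "n \<ge> 38"
    using hi[of 1 5] by (cases "n \<le> 37") (simp_all add: pent_def)
  then have "n \<ge> 39"
    using second[of 3 7] by (cases "n \<le> 38") (simp_all add: pent_def euler_dbl_values euler_sum_values)
  then have "n \<ge> 44"
    using lo[of 2 5] by (cases "n \<le> 43") (simp_all add: pent_def)
  then have "n \<ge> 45"
    using second[of 3 8] by (cases "n \<le> 44") (simp_all add: pent_def euler_dbl_values euler_sum_values)
  then have "n \<ge> 50"
    using hi[of 2 6] by (cases "n \<le> 49") (simp_all add: pent_def)
  then have "n \<ge> 55"
    using lo[of 3 6] by (cases "n \<le> 54") (simp_all add: pent_def)
  then have "n \<ge> 62"
    using hi[of 3 7] by (cases "n \<le> 61") (simp_all add: pent_def)
  then have "n \<ge> 65"
    using lo[of 4 7] by (cases "n \<le> 64") (simp_all add: pent_def)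
  then have "n \<ge> 69"
    using hi[of 4 8] by (cases "n \<le> 68") (simp_all add: pent_def)
  with \<open>n < 69\<close> show False by simp
qed

section \<open>Transfer to F_k through the gaps of the Euler product\<close>

text \<open>For m beyond the degree of (q)_k, the gaps around \<open>pent m\<close> are wide enough
  that only the monomial at \<open>pent m\<close> contributes, leaving a signed copy of
  (q)_k.\<close>

lemma qpoch_mult_euler_nth:
  assumes "tri k < m" "i \<le> tri k"
  shows "fps_nth (qpoch k * euler) (pent m + i) = (-1) ^ m * fps_nth (qpoch k) i"
proof -
  have "fps_nth (qpoch k * euler) (pent m + i) =
      (\<Sum>l=0..pent m + i. fps_nth (qpoch k) l * fps_nth euler (pent m + i - l))"
    by (rule fps_mult_nth)
  also have "\<dots> = (\<Sum>l\<in>{i}. fps_nth (qpoch k) l * fps_nth euler (pent m + i - l))"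
  proof (intro sum.mono_neutral_right ballI)
    fix l assume l: "l \<in> {0..pent m + i} - {i}"
    show "fps_nth (qpoch k) l * fps_nth euler (pent m + i - l) = 0"
    proof (cases "l \<le> tri k")
      case True
      then have "fps_nth euler (pent m + i - l) = 0"
        using assms l by (intro euler_nth_near_pent[of m]) auto
      then show ?thesis by simp
    next
      case False
      then show ?thesis by (simp add: fps_nth_qpoch_eq_0)
    qed
  qed auto
  also have "\<dots> = (-1) ^ m * fps_nth (qpoch k) i"
    using assms by (simp add: euler_nth_pent)
  finally show ?thesis .
qed

theorem theorem1p4:
  fixes k :: nat
  assumes "k \<ge> 7"
  shows "\<not> (\<exists>f :: complex poly. bloch_polya (F_series k + fps_of_poly f))"
proof
  assume "\<exists>f :: complex poly. bloch_polya (F_series k + fps_of_poly f)"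
  then obtain f :: "complex poly" where f: "bloch_polya (F_series k + fps_of_poly f)" by blast
  obtain l where l: "k = Suc l" "l \<ge> 6" using assms by (cases k) auto
  obtain p where p: "fps_X ^ tri k * F_series k = fps_of_poly p - (-1) ^ l * qpoch l * euler"
    using F_series_euler[of l] l by blast
  obtain i where i: "\<bar>fps_nth (qpoch l) i\<bar> > (1 :: int)"
    using qpoch_coeff_large l by blast
  then have i_le: "i \<le> tri l"
    using fps_nth_qpoch_eq_0[of l i, where 'a=int] by (cases "i \<le> tri l") simp_all
  \<comment> \<open>Large enough for the gap condition and, as \<open>pent m\<close> is at least m,
    to push the exponent past both polynomials.\<close>
  define m where "m = Suc (tri k + tri l + degree p + degree f)"
  define N where "N = pent m + i - tri k"
  have N: "pent m + i = N + tri k" "degree f < N" "degree p < N + tri k"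
    using pent_ge[of m] by (auto simp: N_def m_def)
  have "fps_nth (F_series k) N = fps_nth (fps_X ^ tri k * F_series k) (pent m + i)"
    unfolding N fps_X_power_mult_nth by simp
  also have "\<dots> = - fps_nth ((-1) ^ l * (qpoch l * euler)) (pent m + i)"
    unfolding p using N by (simp add: coeff_eq_0 mult.assoc)
  also have "\<dots> = - ((-1) ^ l * ((-1) ^ m * fps_nth (qpoch l) i))"
    using qpoch_mult_euler_nth[of l m i] i_le by (cases "even l") (simp_all add: m_def)
  finally have "\<bar>fps_nth (F_series k) N\<bar> = \<bar>fps_nth (qpoch l) i :: int\<bar>"
    by (simp add: abs_mult power_abs)
  with i have large: "\<bar>fps_nth (F_series k) N\<bar> > (1 :: int)" by simp
  have "fps_nth (F_series k + fps_of_poly f) N = of_int (fps_nth (F_series k) N)"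
    using N assms by (simp add: coeff_eq_0 F_series_nth_of_int[where 'a=complex])
  moreover have "fps_nth (F_series k + fps_of_poly f) N \<in> {of_int (-1), of_int 0, of_int 1}"
    using f unfolding bloch_polya_def by simp
  \<comment> \<open>Integers embed injectively into the complex numbers, so membership descends to
    the integer coefficient.\<close>
  ultimately have "fps_nth (F_series k) N \<in> {-1, 0, 1 :: int}"
    by (simp only: insert_iff of_int_eq_iff empty_iff)
  with large show False by auto
qed

end
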